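(* Let $B$ be an $n\times n$ positive definite Hermitian matrix with eigenvalues $\lambda_1\ge\lambda_2\ge\dots\ge\lambda_n>0$. For (linearly) independent $x,y\in\mathbb C^n$ define $\Phi$ by $0\le\Phi\le\pi/2$ and $\|x\|\|y\|\cos\Phi=|y^*x|$. Then \[ |x^*By|\le\left(\max_{i,j}\frac{\lambda_i\cos^2(\Phi/2)-\lambda_j\sin^2(\Phi/2)}{\lambda_i\cos^2(\Phi/2)+\lambda_j\sin^2(\Phi/2)}\right)\sqrt{x^*Bx}\,\sqrt{y^*By}, \] where the maximum is over all $i,j\in\{1,\dots,n\}$.
   Context: $\|x\|=\sqrt{x^*x}$ is the Euclidean norm on $\mathbb C^n$, and $x^*$ denotes the conjugate transpose. *)

theory Defs
  imports "HOL-Analysis.Analysis" "HOL-Computational_Algebra.Polynomial"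
begin

(* The scalar x^* y: conjugate-linear in the first argument, linear in the second. *)
definition cdot :: "complex ^ 'n \<Rightarrow> complex ^ 'n \<Rightarrow> complex"
  where "cdot x y = (\<Sum>i\<in>UNIV. cnj (x $ i) * y $ i)"

(* The library norm on complex ^ 'n is the Euclidean norm sqrt (x^* x). *)
lemma cdot_self: "cdot x x = complex_of_real ((norm x)\<^sup>2)"
proof -
  have "(norm x)\<^sup>2 = (\<Sum>i\<in>UNIV. (cmod (x $ i))\<^sup>2)"
    by (simp add: norm_vec_def L2_set_def sum_nonneg)
  moreover have "cdot x x = (\<Sum>i\<in>UNIV. complex_of_real ((cmod (x $ i))\<^sup>2))"
    unfolding cdot_def by (intro sum.cong refl) (metis complex_norm_square mult.commute)
  ultimately show ?thesis by simp
qed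

lemma norm_eq_sqrt_cdot: "norm x = sqrt (Re (cdot x x))"
  by (simp add: cdot_self)

definition conj_transpose :: "complex ^ 'n ^ 'm \<Rightarrow> complex ^ 'm ^ 'n"
  where "conj_transpose A = (\<chi> i j. cnj (A $ j $ i))"

definition hermitian :: "complex ^ 'n ^ 'n \<Rightarrow> bool"
  where "hermitian A \<longleftrightarrow> conj_transpose A = A"

lemma hermitian_cdot_real:
  assumes "hermitian A"
  shows "cdot x (A *v x) \<in> \<real>"
proof -
  have A: "cnj (A $ i $ j) = A $ j $ i" for i j
    using assms unfolding hermitian_def conj_transpose_def
    by (metis (no_types, lifting) vec_lambda_beta)
  have "cnj (cdot x (A *v x)) = (\<Sum>i\<in>UNIV. \<Sum>j\<in>UNIV. x $ i * (A $ j $ i * cnj (x $ j)))"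
    by (simp add: cdot_def matrix_vector_mult_def sum_distrib_left A)
  also have "\<dots> = (\<Sum>j\<in>UNIV. \<Sum>i\<in>UNIV. x $ i * (A $ j $ i * cnj (x $ j)))"
    by (rule sum.swap)
  also have "\<dots> = cdot x (A *v x)"
    by (simp add: cdot_def matrix_vector_mult_def sum_distrib_left mult_ac)
  finally show ?thesis by (simp add: Reals_cnj_iff)
qed

(* Taking real parts loses nothing, by hermitian_cdot_real. *)
definition pos_def_hermitian :: "complex ^ 'n ^ 'n \<Rightarrow> bool"
  where "pos_def_hermitian A \<longleftrightarrow>
    hermitian A \<and> (\<forall>x. x \<noteq> 0 \<longrightarrow> Re (cdot x (A *v x)) > 0)"

(* det (t I - A), a determinant over the polynomial ring in t. *)
definition charpoly :: "complex ^ 'n ^ 'n \<Rightarrow> complex poly"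
  where "charpoly A = det (\<chi> i j. (if i = j then [:0, 1:] else 0) - [:A $ i $ j:])"

(* l 1, ..., l n are the eigenvalues of A, listed with algebraic multiplicity. *)
definition eigenvalues_of :: "complex ^ 'n ^ 'n \<Rightarrow> (nat \<Rightarrow> real) \<Rightarrow> bool"
  where "eigenvalues_of A l \<longleftrightarrow>
    charpoly A = (\<Prod>i\<in>{1..CARD('n)}. [:- complex_of_real (l i), 1:])"

end

theory Submission
  imports Defs
begin

text \<open>
  Write \<open>M\<close> and \<open>m\<close> for the largest and smallest eigenvalue, \<open>c = cos (\<Phi> / 2)\<close>,
  \<open>s = sin (\<Phi> / 2)\<close>, and \<open>q z = z\<^sup>* B z\<close>. After multiplying \<open>x\<close> and \<open>y\<close> by scalars (which does
  not affect the angle \<open>\<Phi>\<close>), one may assume that \<open>x\<^sup>* B y\<close> is a nonnegative real and that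
  \<open>q x = q y\<close>. With \<open>u = x + y\<close> and \<open>v = x - y\<close>, polarization gives
  \<open>x\<^sup>* B y / q x = (q u - q v) / (q u + q v)\<close>, so the claim amounts to
  \<open>m s\<^sup>2 q u \<le> M c\<^sup>2 q v\<close>. The Rayleigh bounds \<open>q u \<le> M \<parallel>u\<parallel>\<^sup>2\<close> and \<open>m \<parallel>v\<parallel>\<^sup>2 \<le> q v\<close> reduce this to
  \<open>s\<^sup>2 \<parallel>u\<parallel>\<^sup>2 \<le> c\<^sup>2 \<parallel>v\<parallel>\<^sup>2\<close>, which follows from the definition of \<open>\<Phi>\<close> and
  \<open>2 \<parallel>x\<parallel> \<parallel>y\<parallel> \<le> \<parallel>x\<parallel>\<^sup>2 + \<parallel>y\<parallel>\<^sup>2\<close> (lemmas \<open>angle_sum_diff\<close> and \<open>wielandt_arith\<close>).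

  The Rayleigh bounds need no diagonalization: the quadratic form of a Hermitian matrix attains its
  maximum on the unit sphere, a maximizer is an eigenvector for the maximum (lemma
  \<open>hermitian_max_eigenvalue\<close>), and hence the maximum is a root of the characteristic
  polynomial, i.e. one of the listed eigenvalues. The minimum is treated through \<open>-B\<close>.
  The maximum over \<open>i, j\<close> in the claim is at least the term for \<open>M\<close> and \<open>m\<close>, and this suffices.
\<close>

section \<open>The Hermitian form of a matrix\<close>

lemma cdot_add_left: "cdot (x + y) z = cdot x z + cdot y z"
  by (simp add: cdot_def distrib_right sum.distrib)

lemma cdot_add_right: "cdot z (x + y) = cdot z x + cdot z y"
  by (simp add: cdot_def distrib_left sum.distrib)

lemma cdot_diff_left: "cdot (x - y) z = cdot x z - cdot y z"
  by (simp add: cdot_def left_diff_distrib sum_subtractf)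

lemma cdot_diff_right: "cdot z (x - y) = cdot z x - cdot z y"
  by (simp add: cdot_def right_diff_distrib sum_subtractf)

lemma cdot_scale_left: "cdot (k *s x) y = cnj k * cdot x y"
  by (simp add: cdot_def sum_distrib_left mult_ac)

lemma cdot_scale_right: "cdot x (k *s y) = k * cdot x y"
  by (simp add: cdot_def sum_distrib_left mult_ac)

lemma cdot_commute: "cdot y x = cnj (cdot x y)"
  by (simp add: cdot_def mult.commute)

lemma Re_cdot_self: "Re (cdot x x) = (norm x)\<^sup>2"
  by (simp add: cdot_self)

lemma norm_scale: "norm (k *s (x :: complex ^ 'n)) = cmod k * norm x"
  by (simp add: norm_vec_def L2_set_def norm_mult power_mult_distrib real_sqrt_mult
      flip: sum_distrib_left)

lemma matrix_vector_uminus: "(- A) *v x = - (A *v (x :: complex ^ 'n))"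
  by (simp add: matrix_vector_mult_def vec_eq_iff sum_negf)

lemma hermitian_uminus: "hermitian A \<Longrightarrow> hermitian (- A)"
  by (simp add: hermitian_def conj_transpose_def vec_eq_iff)

lemma hermitian_form_commute:
  assumes "hermitian A"
  shows "cdot y (A *v x) = cnj (cdot x (A *v y))"
proof -
  have A: "cnj (A $ i $ j) = A $ j $ i" for i j
    using assms by (simp add: hermitian_def conj_transpose_def vec_eq_iff)
  have "cdot y (A *v x) = (\<Sum>i\<in>UNIV. \<Sum>j\<in>UNIV. cnj (y $ i) * (A $ i $ j * x $ j))"
    by (simp add: cdot_def matrix_vector_mult_def sum_distrib_left)
  also have "\<dots> = (\<Sum>j\<in>UNIV. \<Sum>i\<in>UNIV. cnj (y $ i) * (A $ i $ j * x $ j))"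
    by (rule sum.swap)
  also have "\<dots> = cnj (cdot x (A *v y))"
    by (simp add: cdot_def matrix_vector_mult_def sum_distrib_left A mult_ac)
  finally show ?thesis .
qed

text \<open>The following is how a maximizer of the Rayleigh quotient is seen to be an eigenvector.\<close>

lemma psd_form_zero_imp_kernel:
  fixes A :: "complex ^ 'n ^ 'n"
  assumes A: "hermitian A" and psd: "\<And>z. 0 \<le> Re (cdot z (A *v z))"
    and zero: "Re (cdot x (A *v x)) = 0"
  shows "A *v x = 0"
proof (rule ccontr)
  define w where "w = A *v x"
  define r where "r = (norm w)\<^sup>2"
  define k where "k = Re (cdot w (A *v w))"
  assume "A *v x \<noteq> 0"
  then have "r > 0" by (simp add: r_def w_def)
  have "k \<ge> 0" by (simp add: k_def psd)
  have wx: "Re (cdot w (A *v x)) = r" by (simp add: r_def w_def Re_cdot_self)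
  then have xw: "Re (cdot x (A *v w)) = r"
    using hermitian_form_commute[OF A, of x w] by simp
  have expand: "0 \<le> 2 * t * r + t\<^sup>2 * k" for t :: real
  proof -
    have "Re (cdot (x + of_real t *s w) (A *v (x + of_real t *s w))) = 2 * t * r + t\<^sup>2 * k"
      by (simp add: matrix_vector_right_distrib vector_scalar_commute cdot_add_left cdot_add_right
          cdot_scale_left cdot_scale_right zero wx xw k_def [symmetric] power2_eq_square
          algebra_simps)
    then show ?thesis using psd by metis
  qed
  \<comment> \<open>At this \<open>t\<close>, the linear term outweighs the quadratic one.\<close>
  have "0 \<le> 2 * (- r / (k + 1)) * r + (- r / (k + 1))\<^sup>2 * k" by (rule expand)
  also have "\<dots> = - (r\<^sup>2 * (k + 2)) / (k + 1)\<^sup>2"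
  proof -
    have "k + 1 \<noteq> 0" using \<open>k \<ge> 0\<close> by simp
    then show ?thesis by (simp add: divide_simps power2_eq_square) (simp add: algebra_simps)
  qed
  also have "\<dots> < 0" using \<open>r > 0\<close> \<open>k \<ge> 0\<close> by simp
  finally show False by simp
qed

section \<open>Extreme eigenvalues and the Rayleigh bounds\<close>

lemma continuous_on_form:
  "continuous_on S (\<lambda>z. Re (cdot z (A *v (z :: complex ^ 'n))))"
  unfolding cdot_def matrix_vector_mult_def by (simp, intro continuous_intros)

lemma hermitian_max_eigenvalue:
  fixes A :: "complex ^ 'n ^ 'n"
  assumes A: "hermitian A"
  obtains \<mu> :: real and v where "v \<noteq> 0" "A *v v = of_real \<mu> *s v"
    "\<And>z. Re (cdot z (A *v z)) \<le> \<mu> * (norm z)\<^sup>2"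
proof -
  let ?S = "sphere (0 :: complex ^ 'n) 1"
  have "?S \<noteq> {}" by simp
  then obtain v where v: "v \<in> ?S"
    and max: "\<And>z. z \<in> ?S \<Longrightarrow> Re (cdot z (A *v z)) \<le> Re (cdot v (A *v v))"
    using continuous_attains_sup[OF compact_sphere _ continuous_on_form] by metis
  define \<mu> where "\<mu> = Re (cdot v (A *v v))"
  have nv: "norm v = 1" using v by simp
  have bound: "Re (cdot z (A *v z)) \<le> \<mu> * (norm z)\<^sup>2" for z
  proof (cases "z = 0")
    case False
    define a :: complex where "a = of_real (norm z)"
    define w where "w = inverse a *s z"
    have a: "a \<noteq> 0" using False by (simp add: a_def)
    have "norm w = 1" using False by (simp add: w_def norm_scale a_def norm_inverse)
    then have le: "Re (cdot w (A *v w)) \<le> \<mu>" using max by (simp add: \<mu>_def)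
    have z: "z = a *s w" using a by (simp add: w_def)
    have "Re (cdot z (A *v z)) = (norm z)\<^sup>2 * Re (cdot w (A *v w))"
      by (subst (1 2) z) (simp add: vector_scalar_commute cdot_scale_left cdot_scale_right a_def power2_eq_square)
    then show ?thesis using mult_left_mono[OF le, of "(norm z)\<^sup>2"] by (simp add: mult.commute)
  qed (simp add: cdot_def)
  define C where "C = mat (of_real \<mu>) - A"
  have Cv: "C *v z = of_real \<mu> *s z - A *v z" for z
  proof -
    have "mat (of_real \<mu>) *v z = of_real \<mu> *s z"
      by (simp add: mat_def matrix_vector_mult_def vec_eq_iff if_distrib if_distribR sum.delta
          cong: if_cong)
    then show ?thesis by (simp add: C_def matrix_vector_mult_diff_rdistrib)
  qed
  have "hermitian C"
    using A by (auto simp: C_def hermitian_def conj_transpose_def vec_eq_iff mat_def)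
  moreover have form: "Re (cdot z (C *v z)) = \<mu> * (norm z)\<^sup>2 - Re (cdot z (A *v z))" for z
    by (simp add: Cv cdot_diff_right cdot_scale_right cdot_self)
  ultimately have "C *v v = 0"
    using bound by (intro psd_form_zero_imp_kernel) (auto simp: nv \<mu>_def)
  then have "A *v v = of_real \<mu> *s v" by (simp add: Cv)
  moreover have "v \<noteq> 0" using nv by auto
  ultimately show thesis using bound that by blast
qed

lemma poly_charpoly: "poly (charpoly A) t = det (mat t - A)"
proof -
  have "poly (charpoly A) t = (\<Sum>p | p permutes UNIV. of_int (sign p) *
      (\<Prod>i\<in>UNIV. poly ((if i = p i then [:0, 1:] else 0) - [:A $ i $ p i:]) t))"
    by (simp add: charpoly_def det_def poly_sum poly_prod)
  also have "\<dots> = det (mat t - A)"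
    unfolding det_def
    by (intro sum.cong arg_cong2[where f = "(*)"] prod.cong refl) (simp add: mat_def)
  finally show ?thesis .
qed

lemma eigenvalue_is_listed:
  fixes A :: "complex ^ 'n ^ 'n"
  assumes l: "eigenvalues_of A l" and v: "v \<noteq> 0" "A *v v = of_real \<mu> *s v"
  obtains i where "i \<in> {1..CARD('n)}" "l i = \<mu>"
proof -
  have "mat (of_real \<mu>) *v v = of_real \<mu> *s v"
    by (simp add: mat_def matrix_vector_mult_def vec_eq_iff if_distrib if_distribR sum.delta
        cong: if_cong)
  then have "(mat (of_real \<mu>) - A) *v v = 0"
    using v by (simp add: matrix_vector_mult_diff_rdistrib)
  then have "\<not> invertible (mat (of_real \<mu>) - A)"
    using v(1) by (metis invertible_left_inverse matrix_left_invertible_ker)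
  then have "poly (charpoly A) (of_real \<mu>) = 0"
    by (simp add: poly_charpoly invertible_det_nz)
  then have "\<exists>i\<in>{1..CARD('n)}. - complex_of_real (l i) + of_real \<mu> = 0"
    using l by (simp add: eigenvalues_of_def poly_prod)
  then obtain i where "i \<in> {1..CARD('n)}" "complex_of_real \<mu> = of_real (l i)"
    by (auto simp: add_eq_0_iff)
  then show thesis using that by simp
qed

lemma rayleigh_upper:
  fixes A :: "complex ^ 'n ^ 'n"
  assumes "hermitian A" "eigenvalues_of A l" and M: "\<And>i. i \<in> {1..CARD('n)} \<Longrightarrow> l i \<le> M"
  shows "Re (cdot z (A *v z)) \<le> M * (norm z)\<^sup>2"
proof -
  obtain \<mu> :: real and v where v: "v \<noteq> 0" "A *v v = of_real \<mu> *s v"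
    and *: "\<And>z. Re (cdot z (A *v z)) \<le> \<mu> * (norm z)\<^sup>2"
    using hermitian_max_eigenvalue[OF assms(1)] by blast
  obtain i where "i \<in> {1..CARD('n)}" "l i = \<mu>" using eigenvalue_is_listed[OF assms(2) v] .
  with M have "\<mu> \<le> M" by blast
  then show ?thesis using order_trans[OF * mult_right_mono[of \<mu> M]] by simp
qed

lemma rayleigh_lower:
  fixes A :: "complex ^ 'n ^ 'n"
  assumes "hermitian A" "eigenvalues_of A l" and m: "\<And>i. i \<in> {1..CARD('n)} \<Longrightarrow> m \<le> l i"
  shows "m * (norm z)\<^sup>2 \<le> Re (cdot z (A *v z))"
proof -
  obtain \<mu> :: real and v where v: "v \<noteq> 0" "(- A) *v v = of_real \<mu> *s v"
    and *: "\<And>z. Re (cdot z ((- A) *v z)) \<le> \<mu> * (norm z)\<^sup>2"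
    using hermitian_max_eigenvalue[OF hermitian_uminus[OF assms(1)]] by blast
  have "A *v v = of_real (- \<mu>) *s v"
    using v(2) by (simp add: matrix_vector_uminus minus_equation_iff[of "A *v v"])
  then obtain i where "i \<in> {1..CARD('n)}" "l i = - \<mu>"
    using eigenvalue_is_listed[OF assms(2) v(1)] by blast
  with m have "m \<le> - \<mu>" by metis
  then have "m * (norm z)\<^sup>2 \<le> - \<mu> * (norm z)\<^sup>2" by (intro mult_right_mono) auto
  moreover have "Re (cdot z ((- A) *v z)) = - Re (cdot z (A *v z))"
    by (simp add: matrix_vector_uminus cdot_def sum_negf)
  ultimately show ?thesis using *[of z] by simp
qed

section \<open>The generalized Wielandt inequality\<close>

lemma angle_sum_diff:
  fixes x y :: "complex ^ 'n"
  assumes le: "cmod (cdot x y) \<le> norm x * norm y * cos \<Phi>" and cos: "0 \<le> cos \<Phi>"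
  shows "(sin (\<Phi> / 2))\<^sup>2 * (norm (x + y))\<^sup>2 \<le> (cos (\<Phi> / 2))\<^sup>2 * (norm (x - y))\<^sup>2"
proof -
  define r where "r = Re (cdot x y)"
  have yx: "Re (cdot y x) = r" by (simp add: r_def cdot_commute[of y x])
  have u: "(norm (x + y))\<^sup>2 = (norm x)\<^sup>2 + (norm y)\<^sup>2 + 2 * r"
    by (simp add: cdot_add_left cdot_add_right yx r_def[symmetric] flip: Re_cdot_self)
  have v: "(norm (x - y))\<^sup>2 = (norm x)\<^sup>2 + (norm y)\<^sup>2 - 2 * r"
    by (simp add: cdot_diff_left cdot_diff_right yx r_def[symmetric] flip: Re_cdot_self)
  have c: "(cos (\<Phi> / 2))\<^sup>2 = (1 + cos \<Phi>) / 2"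
    using cos_double_cos[of "\<Phi> / 2"] by simp
  have s: "(sin (\<Phi> / 2))\<^sup>2 = (1 - cos \<Phi>) / 2"
    using cos_double_sin[of "\<Phi> / 2"] by simp
  have "2 * r \<le> 2 * (norm x * norm y) * cos \<Phi>"
    using le complex_Re_le_cmod[of "cdot x y"] by (simp add: r_def)
  also have "\<dots> \<le> ((norm x)\<^sup>2 + (norm y)\<^sup>2) * cos \<Phi>"
    using sum_squares_bound[of "norm x" "norm y"] cos by (intro mult_right_mono) auto
  finally show ?thesis unfolding u v c s by (simp add: field_simps)
qed

lemma wielandt_arith:
  fixes P Q U V M m c s :: real
  assumes "P \<le> M * U" "m * V \<le> Q" "s * U \<le> c * V" "0 \<le> s" "0 \<le> c" "0 \<le> m" "0 \<le> M"
  shows "(P - Q) * (M * c + m * s) \<le> (M * c - m * s) * (P + Q)"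
proof -
  have "m * s * P \<le> m * s * (M * U)" using assms by (intro mult_left_mono) auto
  also have "\<dots> = m * M * (s * U)" by simp
  also have "\<dots> \<le> m * M * (c * V)" using assms by (intro mult_left_mono) auto
  also have "\<dots> = M * c * (m * V)" by simp
  also have "\<dots> \<le> M * c * Q" using assms by (intro mult_left_mono) auto
  finally show ?thesis by (simp add: algebra_simps)
qed

lemma generalized_wielandt:
  fixes A :: "complex ^ 'n ^ 'n" and x y :: "complex ^ 'n" and m M \<Phi> :: real
  defines "D \<equiv> M * (cos (\<Phi> / 2))\<^sup>2 + m * (sin (\<Phi> / 2))\<^sup>2"
    and "N \<equiv> M * (cos (\<Phi> / 2))\<^sup>2 - m * (sin (\<Phi> / 2))\<^sup>2"
  assumes A: "hermitian A"
    and upper: "\<And>z. Re (cdot z (A *v z)) \<le> M * (norm z)\<^sup>2"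
    and lower: "\<And>z. m * (norm z)\<^sup>2 \<le> Re (cdot z (A *v z))"
    and mM: "0 \<le> m" "0 \<le> M"
    and pos: "0 < Re (cdot x (A *v x))" "0 < Re (cdot y (A *v y))"
    and angle: "cmod (cdot x y) \<le> norm x * norm y * cos \<Phi>" "0 \<le> cos \<Phi>"
  shows "cmod (cdot x (A *v y)) * D
    \<le> N * (sqrt (Re (cdot x (A *v x))) * sqrt (Re (cdot y (A *v y))))"
proof -
  let ?q = "\<lambda>z. Re (cdot z (A *v z))"
  \<comment> \<open>This is the claim when \<open>?q u = ?q v\<close> and \<open>u\<^sup>* A v \<ge> 0\<close>; the vectors are scaled to that case below.\<close>
  have balanced: "4 * Re (cdot u (A *v v)) * D \<le> 2 * N * (?q u + ?q v)"
    if "cmod (cdot u v) \<le> norm u * norm v * cos \<Phi>" for u v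
  proof -
    have vu: "Re (cdot v (A *v u)) = Re (cdot u (A *v v))"
      using hermitian_form_commute[OF A, of v u] by simp
    have "(?q (u + v) - ?q (u - v)) * D \<le> N * (?q (u + v) + ?q (u - v))"
      unfolding D_def N_def
      by (rule wielandt_arith[OF upper lower angle_sum_diff[OF that angle(2)]]) (simp_all add: mM)
    moreover have "?q (u + v) - ?q (u - v) = 4 * Re (cdot u (A *v v))"
      "?q (u + v) + ?q (u - v) = 2 * (?q u + ?q v)"
      using vu by (simp_all add: matrix_vector_right_distrib matrix_vector_mult_diff_distrib
          cdot_add_left cdot_add_right cdot_diff_left cdot_diff_right)
    ultimately show ?thesis by (simp only: mult_ac)
  qed
  define a where "a = sqrt (?q x)"
  define b where "b = sqrt (?q y)"
  have ab: "a > 0" "b > 0" "?q x = a\<^sup>2" "?q y = b\<^sup>2" using pos by (auto simp: a_def b_def)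
  define w where "w = cdot x (A *v y)"
  obtain e :: complex where e: "cmod e = 1" "w * e = of_real (cmod w)"
  proof (cases "w = 0")
    case True then show thesis using that[of 1] by simp
  next
    case False
    then show thesis
      using that[of "of_real (cmod w) / w"] by (simp add: norm_divide)
  qed
  have ee: "e * cnj e = 1" using e(1) complex_norm_square[of e] by simp
  define u where "u = complex_of_real b *s x"
  define v where "v = (complex_of_real a * e) *s y"
  have qu: "?q u = b\<^sup>2 * a\<^sup>2"
    using ab by (simp add: u_def vector_scalar_commute cdot_scale_left cdot_scale_right
        power2_eq_square)
  have "cdot v (A *v v) = of_real (a\<^sup>2) * (e * cnj e) * cdot y (A *v y)"
    by (simp add: v_def vector_scalar_commute cdot_scale_left cdot_scale_right
        power2_eq_square mult_ac)
  then have qv: "?q v = a\<^sup>2 * b\<^sup>2" using ab ee by simp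
  have "cdot u (A *v v) = of_real (a * b) * (w * e)"
    by (simp add: u_def v_def w_def vector_scalar_commute cdot_scale_left cdot_scale_right
        mult_ac)
  then have uv: "Re (cdot u (A *v v)) = a * b * cmod w" by (simp add: e)
  have "cmod (cdot u v) = a * b * cmod (cdot x y)"
    using ab e by (simp add: u_def v_def cdot_scale_left cdot_scale_right norm_mult)
  also have "\<dots> \<le> a * b * (norm x * norm y * cos \<Phi>)"
    using ab angle by (intro mult_left_mono) auto
  also have "\<dots> = norm u * norm v * cos \<Phi>"
    using ab e by (simp add: u_def v_def norm_scale norm_mult)
  finally have "4 * (a * b * cmod w) * D \<le> 2 * N * (b\<^sup>2 * a\<^sup>2 + a\<^sup>2 * b\<^sup>2)"
    using balanced[of u v] by (simp add: qu qv uv)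
  then have "(a * b) * (cmod w * D) \<le> (a * b) * (N * (a * b))"
    by (simp add: power2_eq_square algebra_simps)
  then have "cmod w * D \<le> N * (a * b)" using ab by (simp add: mult_le_cancel_left_pos)
  then show ?thesis by (simp add: w_def a_def b_def)
qed

theorem mainTheorem6:
  fixes B :: "complex ^ 'n ^ 'n" and x y :: "complex ^ 'n"
    and l :: "nat \<Rightarrow> real" and \<Phi> :: real
  assumes "pos_def_hermitian B"
    and "eigenvalues_of B l"
    and "antimono_on {1..CARD('n)} l"
    and "l CARD('n) > 0"
    and "x \<noteq> y" and "vec.independent {x, y}"
    and "0 \<le> \<Phi>" and "\<Phi> \<le> pi / 2"
    and "norm x * norm y * cos \<Phi> = cmod (cdot y x)"
  shows "cmod (cdot x (B *v y)) \<le>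
    (MAX (i, j) \<in> {1..CARD('n)} \<times> {1..CARD('n)}.
        (l i * (cos (\<Phi> / 2))\<^sup>2 - l j * (sin (\<Phi> / 2))\<^sup>2) /
        (l i * (cos (\<Phi> / 2))\<^sup>2 + l j * (sin (\<Phi> / 2))\<^sup>2))
    * sqrt (Re (cdot x (B *v x))) * sqrt (Re (cdot y (B *v y)))"
proof -
  let ?f = "\<lambda>(i, j). (l i * (cos (\<Phi> / 2))\<^sup>2 - l j * (sin (\<Phi> / 2))\<^sup>2) /
        (l i * (cos (\<Phi> / 2))\<^sup>2 + l j * (sin (\<Phi> / 2))\<^sup>2)"
  let ?I = "{1..CARD('n)}"
  let ?n = "CARD('n)"
  let ?R = "sqrt (Re (cdot x (B *v x))) * sqrt (Re (cdot y (B *v y)))"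
  have n: "1 \<in> ?I" "?n \<in> ?I" using zero_less_card_finite[where 'a = 'n] by (auto simp: Suc_le_eq)
  have mono: "l j \<le> l i" if "i \<in> ?I" "j \<in> ?I" "i \<le> j" for i j
    using assms(3) that by (auto simp: monotone_on_def)
  have hi: "l i \<le> l 1" and lo: "l ?n \<le> l i" if "i \<in> ?I" for i
    using mono[of 1 i] mono[of i ?n] n that by auto
  have l1: "l 1 > 0" using hi[of ?n] n assms(4) by simp
  have H: "hermitian B" and P: "\<And>z. z \<noteq> 0 \<Longrightarrow> Re (cdot z (B *v z)) > 0"
    using assms(1) by (auto simp: pos_def_hermitian_def)
  have "x \<noteq> 0" "y \<noteq> 0" using vec.dependent_zero[of "{x, y}"] assms(6) by auto
  have cos: "0 \<le> cos \<Phi>" using assms(7,8) by (intro cos_ge_zero) auto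
  have "cmod (cdot x y) = cmod (cdot y x)" by (simp add: cdot_commute[of y x])
  then have angle: "cmod (cdot x y) \<le> norm x * norm y * cos \<Phi>" using assms(9) by simp
  define D where "D = l 1 * (cos (\<Phi> / 2))\<^sup>2 + l ?n * (sin (\<Phi> / 2))\<^sup>2"
  define N where "N = l 1 * (cos (\<Phi> / 2))\<^sup>2 - l ?n * (sin (\<Phi> / 2))\<^sup>2"
  have "cos (\<Phi> / 2) > 0" using assms(7,8) pi_gt_zero by (intro cos_gt_zero_pi) linarith+
  then have D: "D > 0" using l1 assms(4) by (simp add: D_def add_pos_nonneg)
  have "cmod (cdot x (B *v y)) * D \<le> N * ?R"
    unfolding D_def N_def
    by (rule generalized_wielandt[OF H rayleigh_upper[OF H assms(2) hi]
          rayleigh_lower[OF H assms(2) lo]])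
      (use l1 assms(4) P \<open>x \<noteq> 0\<close> \<open>y \<noteq> 0\<close> angle cos in auto)
  then have "cmod (cdot x (B *v y)) \<le> N / D * ?R"
    using D by (simp add: field_simps)
  also have "N / D \<le> Max (?f ` (?I \<times> ?I))"
  proof (rule Max_ge)
    show "N / D \<in> ?f ` (?I \<times> ?I)"
      by (rule image_eqI[of _ _ "(1, ?n)"]) (use n in \<open>auto simp: N_def D_def\<close>)
  qed simp
  then have "N / D * ?R \<le> Max (?f ` (?I \<times> ?I)) * ?R"
    using P[OF \<open>x \<noteq> 0\<close>] P[OF \<open>y \<noteq> 0\<close>] by (intro mult_right_mono) auto
  finally show ?thesis by (simp add: mult.assoc)
qed

end
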